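(* Let $\mathcal{X}$ be a finite set, let $\pi$ be a probability measure on $\mathcal{X}$ with strictly positive masses, and let $G$ be the Gibbs kernel of a partition $\mathcal{X}=\bigsqcup_{i=1}^k\mathcal{O}_i$ into non-empty sets. For any $\pi$-reversible, ergodic and positive-definite transition matrix $P$ on $\mathcal{X}$, if $G\ne\Pi$ and $P\neq\Pi$, then $GP\ne\Pi$.
   Context: The Gibbs kernel is $G(x,y)=\pi(y)/\pi(\mathcal{O}(x))$ if $y\in\mathcal{O}(x)$ and $0$ otherwise, where $\mathcal{O}(x)$ is the block containing $x$ and $\pi(A)=\sum_{z\in A}\pi(z)$. $\Pi$ is the matrix all of whose rows equal $\pi$. Ergodic means irreducible and aperiodic. $P$ is positive-definite if $\sum_xf(x)(Pf)(x)\pi(x)>0$ for all non-zero $f:\mathcal{X}\to\mathbb{R}$. *)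

theory Defs
  imports "HOL-Probability.Probability"
begin

text \<open>The finite state space is a type of class finite, a probability measure on it is a pmf,
  and a kernel is a square matrix over the state space, \<open>P $ x $ y\<close> being the probability of
  moving from \<open>x\<close> to \<open>y\<close>. Kernels are composed with \<open>**\<close> and act on functions by \<open>*v\<close>.\<close>

definition transition_matrix :: "real^'x^'x \<Rightarrow> bool" where
  "transition_matrix P \<longleftrightarrow> (\<forall>x y. P $ x $ y \<ge> 0) \<and> (\<forall>x. (\<Sum>y\<in>UNIV. P $ x $ y) = 1)"

text \<open>The power operation \<open>^\<close> on \<open>real^'x^'x\<close> is entrywise, hence this definition.\<close>

primrec mpow :: "real^'x^'x \<Rightarrow> nat \<Rightarrow> real^'x^'x" where
  "mpow P 0 = mat 1"
| "mpow P (Suc n) = P ** mpow P n"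

definition irreducible_kernel :: "real^'x^'x \<Rightarrow> bool" where
  "irreducible_kernel P \<longleftrightarrow> (\<forall>x y. \<exists>n. mpow P n $ x $ y > 0)"

definition period :: "real^'x^'x \<Rightarrow> 'x \<Rightarrow> nat" where
  "period P x = Gcd {n. n \<ge> 1 \<and> mpow P n $ x $ x > 0}"

definition aperiodic_kernel :: "real^'x^'x \<Rightarrow> bool" where
  "aperiodic_kernel P \<longleftrightarrow> (\<forall>x. period P x = 1)"

definition ergodic_kernel :: "real^'x^'x \<Rightarrow> bool" where
  "ergodic_kernel P \<longleftrightarrow> irreducible_kernel P \<and> aperiodic_kernel P"

definition reversible_kernel :: "'x pmf \<Rightarrow> real^'x^'x \<Rightarrow> bool" where
  "reversible_kernel \<pi> P \<longleftrightarrow> (\<forall>x y. pmf \<pi> x * P $ x $ y = pmf \<pi> y * P $ y $ x)"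

definition positive_definite_kernel :: "'x pmf \<Rightarrow> real^'x^'x \<Rightarrow> bool" where
  "positive_definite_kernel \<pi> P \<longleftrightarrow>
     (\<forall>f :: real^'x. f \<noteq> 0 \<longrightarrow> (\<Sum>x\<in>UNIV. f $ x * (P *v f) $ x * pmf \<pi> x) > 0)"

definition stationary_kernel :: "'x pmf \<Rightarrow> real^'x^'x" where
  "stationary_kernel \<pi> = (\<chi> x y. pmf \<pi> y)"

text \<open>Meaningful when \<open>\<O>\<close> is a partition of the type.\<close>

definition block :: "'x set set \<Rightarrow> 'x \<Rightarrow> 'x set" where
  "block \<O> x = (THE B. B \<in> \<O> \<and> x \<in> B)"

definition gibbs_kernel :: "'x pmf \<Rightarrow> 'x set set \<Rightarrow> real^'x^'x" where
  "gibbs_kernel \<pi> \<O> =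
     (\<chi> x y. if y \<in> block \<O> x then pmf \<pi> y / (\<Sum>z\<in>block \<O> x. pmf \<pi> z) else 0)"

end

theory Submission
  imports Defs
begin

text \<open>Write G for the Gibbs kernel and \<Pi> for \<open>stationary_kernel \<pi>\<close>.
  Reversibility makes \<pi> invariant, so \<Pi> P = \<Pi>
  (\<open>stationary_kernel_mult_reversible\<close>). Positive-definiteness makes P invertible
  (\<open>positive_definite_kernel_right_inverse\<close>). If G P = \<Pi>, then G P = \<Pi> P, and
  cancelling P on the right gives G = \<Pi>, a contradiction.\<close>

lemma stationary_kernel_mult_reversible:
  assumes "transition_matrix P" and "reversible_kernel \<pi> P"
  shows "stationary_kernel \<pi> ** P = stationary_kernel \<pi>"
proof -
  have "(\<Sum>x\<in>UNIV. pmf \<pi> x * P $ x $ y) = pmf \<pi> y" for y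
  proof -
    have "(\<Sum>x\<in>UNIV. pmf \<pi> x * P $ x $ y) = (\<Sum>x\<in>UNIV. pmf \<pi> y * P $ y $ x)"
      using assms(2) unfolding reversible_kernel_def by (intro sum.cong) auto
    also have "\<dots> = pmf \<pi> y"
      using assms(1) unfolding transition_matrix_def by (simp flip: sum_distrib_left)
    finally show ?thesis .
  qed
  then show ?thesis
    by (simp add: stationary_kernel_def matrix_matrix_mult_def vec_eq_iff)
qed

text \<open>A non-zero f with P f = 0 would make the quadratic form vanish at f, so P is injective.
  For a square matrix this yields a left inverse, which is also a right inverse; the right one is
  what cancels P in a product ending in P.\<close>

lemma positive_definite_kernel_right_inverse:
  assumes "positive_definite_kernel \<pi> P"
  obtains Q where "P ** Q = mat 1"
proof -
  have "f = 0" if "P *v f = 0" for f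
  proof (rule ccontr)
    assume "f \<noteq> 0"
    then have "(\<Sum>x\<in>UNIV. f $ x * (P *v f) $ x * pmf \<pi> x) > 0"
      using assms unfolding positive_definite_kernel_def by blast
    with that show False by simp
  qed
  then have "\<exists>Q. Q ** P = mat 1"
    by (simp add: matrix_left_invertible_ker)
  then show ?thesis
    using that matrix_left_right_inverse by blast
qed

theorem corollary7p2:
  fixes \<pi> :: "'x::finite pmf" and \<O> :: "'x set set" and P :: "real^'x^'x"
  assumes "\<And>x. pmf \<pi> x > 0"
    and "partition_on UNIV \<O>"
    and "transition_matrix P"
    and "reversible_kernel \<pi> P"
    and "ergodic_kernel P"
    and "positive_definite_kernel \<pi> P"
    and "gibbs_kernel \<pi> \<O> \<noteq> stationary_kernel \<pi>"
    and "P \<noteq> stationary_kernel \<pi>"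
  shows "gibbs_kernel \<pi> \<O> ** P \<noteq> stationary_kernel \<pi>"
proof
  assume "gibbs_kernel \<pi> \<O> ** P = stationary_kernel \<pi>"
  \<comment> \<open>Expanding \<Pi> to \<Pi> P exposes the same right factor P on both
    sides.\<close>
  then have eq: "gibbs_kernel \<pi> \<O> ** P = stationary_kernel \<pi> ** P"
    using stationary_kernel_mult_reversible assms(3,4) by metis
  obtain Q where Q: "P ** Q = mat 1"
    using positive_definite_kernel_right_inverse assms(6) by blast
  have "gibbs_kernel \<pi> \<O> = gibbs_kernel \<pi> \<O> ** P ** Q"
    by (simp add: Q flip: matrix_mul_assoc)
  also have "\<dots> = stationary_kernel \<pi>"
    unfolding eq by (simp add: Q flip: matrix_mul_assoc)
  finally show False
    using assms(7) by contradiction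
qed

end
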